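(* For all $m_1,\ldots,m_r,k_1,\ldots,k_r\in\mathbb{Z}_{\ge0}$, \[\mathbb{B}^{(-k_1,\ldots,-k_r)}_{m_1,\ldots,m_r}=\mathbb{B}^{(-m_1,\ldots,-m_r)}_{k_1,\ldots,k_r}.\]
   Context: For $s_1,\ldots,s_r\in\mathbb{C}$ and $|z_j|\le1$ (resp. as a rational function when all $s_j$ are non-positive integers), $\mathrm{Li}^{\sqcup\!\sqcup}_{s_1,\ldots,s_r}(z_1,\ldots,z_r)=\sum_{l_1,\ldots,l_r\ge1}\frac{z_1^{l_1}\cdots z_r^{l_r}}{l_1^{s_1}(l_1+l_2)^{s_2}\cdots(l_1+\cdots+l_r)^{s_r}}$. Write $X_j=\sum_{\nu=j}^r x_\nu$. The numbers $\mathbb{B}^{(s_1,\ldots,s_r)}_{m_1,\ldots,m_r}$ are defined by \[\frac{\mathrm{Li}^{\sqcup\!\sqcup}_{s_1,\ldots,s_r}(1-e^{-X_1},\ldots,1-e^{-X_r})}{\prod_{j=1}^r(1-e^{-X_j})}=\sum_{l_1,\ldots,l_r\ge1}\frac{\prod_{j=1}^r(1-e^{-X_j})^{l_j-1}}{\prod_{j=1}^r(l_1+\cdots+l_j)^{s_j}}=\sum_{m_1,\ldots,m_r\ge0}\mathbb{B}^{(s_1,\ldots,s_r)}_{m_1,\ldots,m_r}\frac{x_1^{m_1}\cdots x_r^{m_r}}{m_1!\cdots m_r!},\] the series converging for $(x_j)$ near $0$ with $|1-e^{-X_j}|<1$ for all $j$. *)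

theory Defs
  imports "HOL-Complex_Analysis.Complex_Analysis" "HOL-Library.FuncSet"
begin

text \<open>
  An \<open>r\<close>-tuple is a function on \<^typ>\<open>nat\<close> of which only the values on \<open>{1..r}\<close> matter.
  Where tuples index a sum, the set \<open>{1..r} \<rightarrow>\<^sub>E A\<close> of extensional functions is used,
  so that every tuple occurs exactly once.
\<close>

text \<open>
  The series is summed unconditionally. For every \<open>s\<close> it converges when all
  \<open>norm (z j) < 1\<close>, and it is used only there, at \<open>z j = 1 - exp (- X j)\<close> near \<open>0\<close>;
  no analytic continuation (in particular no rational continuation for non-positive integer
  \<open>s\<close>) is needed.
\<close>

definition Li_sh :: "nat \<Rightarrow> (nat \<Rightarrow> complex) \<Rightarrow> (nat \<Rightarrow> complex) \<Rightarrow> complex" where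
  "Li_sh r s z =
     (\<Sum>\<^sub>\<infinity>l \<in> {1..r} \<rightarrow>\<^sub>E {1::nat..}.
        (\<Prod>j=1..r. z j ^ l j) / (\<Prod>j=1..r. of_nat (\<Sum>i=1..j. l i) powr s j))"

definition tail_sum :: "nat \<Rightarrow> (nat \<Rightarrow> complex) \<Rightarrow> nat \<Rightarrow> complex" where
  "tail_sum r x j = (\<Sum>\<nu>=j..r. x \<nu>)"

text \<open>
  The quotient of \<^const>\<open>Li_sh\<close> by the product of the \<open>1 - exp (- X j)\<close> is \<open>0 / 0\<close> at the
  origin; the series below is its continuous version, see \<open>bern_gen_eq_Li_sh\<close>.
\<close>

definition bern_gen :: "nat \<Rightarrow> (nat \<Rightarrow> complex) \<Rightarrow> (nat \<Rightarrow> complex) \<Rightarrow> complex" where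
  "bern_gen r s x =
     (\<Sum>\<^sub>\<infinity>l \<in> {1..r} \<rightarrow>\<^sub>E {1::nat..}.
        (\<Prod>j=1..r. (1 - exp (- tail_sum r x j)) ^ (l j - 1)) /
        (\<Prod>j=1..r. of_nat (\<Sum>i=1..j. l i) powr s j))"

lemma bern_gen_eq_Li_sh:
  assumes "\<And>j. j \<in> {1..r} \<Longrightarrow> exp (- tail_sum r x j) \<noteq> 1"
  shows "bern_gen r s x =
           Li_sh r s (\<lambda>j. 1 - exp (- tail_sum r x j)) / (\<Prod>j=1..r. 1 - exp (- tail_sum r x j))"
proof -
  define z where "z = (\<lambda>j. 1 - exp (- tail_sum r x j))"
  have nz: "z j \<noteq> 0" if "j \<in> {1..r}" for j
    using assms[OF that] by (auto simp: z_def)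
  have "(\<Prod>j=1..r. z j ^ (l j - 1)) = (\<Prod>j=1..r. z j ^ l j) * inverse (\<Prod>j=1..r. z j)"
    if l: "l \<in> {1..r} \<rightarrow>\<^sub>E {1::nat..}" for l
  proof -
    have "(\<Prod>j=1..r. z j ^ (l j - 1)) = (\<Prod>j=1..r. z j ^ l j / z j)"
    proof (rule prod.cong)
      fix j assume j: "j \<in> {1..r}"
      then have "l j \<ge> 1" using l by (auto dest: PiE_mem)
      then show "z j ^ (l j - 1) = z j ^ l j / z j"
        using nz[OF j] by (simp add: power_diff)
    qed simp
    also have "\<dots> = (\<Prod>j=1..r. z j ^ l j) * inverse (\<Prod>j=1..r. z j)"
      unfolding prod_dividef by (rule divide_inverse)
    finally show ?thesis .
  qed
  then have "bern_gen r s x =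
     (\<Sum>\<^sub>\<infinity>l \<in> {1..r} \<rightarrow>\<^sub>E {1::nat..}.
        ((\<Prod>j=1..r. z j ^ l j) / (\<Prod>j=1..r. of_nat (\<Sum>i=1..j. l i) powr s j))
          * inverse (\<Prod>j=1..r. z j))"
    unfolding bern_gen_def z_def[symmetric]
    by (intro infsum_cong) (simp add: z_def divide_inverse mult_ac)
  also have "\<dots> = Li_sh r s z / (\<Prod>j=1..r. z j)"
    unfolding Li_sh_def by (simp add: infsum_cmult_left' divide_inverse del: of_nat_sum)
  finally show ?thesis by (simp add: z_def)
qed

definition is_bern_expansion ::
    "nat \<Rightarrow> (nat \<Rightarrow> complex) \<Rightarrow> ((nat \<Rightarrow> nat) \<Rightarrow> complex) \<Rightarrow> bool" where
  "is_bern_expansion r s c \<longleftrightarrow>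
     (\<exists>\<epsilon>>0. \<forall>x. (\<forall>j\<in>{1..r}. norm (x j) < \<epsilon>) \<longrightarrow>
        ((\<lambda>m. c m * ((\<Prod>j=1..r. x j ^ m j) / (\<Prod>j=1..r. fact (m j))))
           has_sum bern_gen r s x) ({1..r} \<rightarrow>\<^sub>E (UNIV :: nat set)))"

text \<open>
  The expansion determines \<open>c\<close> only on extensional functions, hence the description of a
  single coefficient rather than of the whole family \<open>c\<close>, and the restriction of \<open>m\<close>.
\<close>

definition multi_poly_bern :: "nat \<Rightarrow> (nat \<Rightarrow> complex) \<Rightarrow> (nat \<Rightarrow> nat) \<Rightarrow> complex" where
  "multi_poly_bern r s m =
     (THE b. \<exists>c. is_bern_expansion r s c \<and> b = c (restrict m {1..r}))"

end

theory Submission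
  imports Defs
begin

text \<open>
  With \<open>L j = l 1 + \<dots> + l j\<close>, the product \<open>\<Prod>j. L j ^ k j\<close> has a finite Newton expansion
  \<open>\<Sum>p. D p k * (\<Prod>j. (l j - 1) choose p j)\<close>, where \<open>D p k\<close> is its iterated difference at
  \<open>l = (1, \<dots>, 1)\<close>. Summing over \<open>l\<close> replaces \<open>(l j - 1) choose p j\<close> by
  \<open>z ^ p j / (1 - z) ^ (p j + 1) = u * (u - 1) ^ p j\<close> with \<open>z = 1 - 1 / u\<close> and \<open>u = exp (X j)\<close>.
  Conversely \<open>\<Prod>j. exp (X j) ^ l j = \<Prod>j. exp (L j * x j)\<close> has the Taylor coefficients
  \<open>\<Prod>j. L j ^ m j\<close>, so that \<open>\<Prod>j. u * (u - 1) ^ p j\<close>, being an iterated difference of these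
  products, has the Taylor coefficients \<open>D p m\<close>. Hence the coefficient in question is
  \<open>\<Sum>p. D p k * D p m\<close>, which is symmetric in \<open>k\<close> and \<open>m\<close>.
\<close>

section \<open>Unconditional sums over products and finite index sets\<close>

text \<open>Absolute summability of the factors makes the product family summable, so the product
  formula for \<open>infsum\<close> upgrades to \<open>has_sum\<close>. It serves both the series
  over \<open>l\<close> and the Taylor series over \<open>m\<close>.\<close>

lemma has_sum_prod_PiE_abs:
  fixes f :: "'a \<Rightarrow> 'b \<Rightarrow> complex"
  assumes "finite A" "\<And>x. x \<in> A \<Longrightarrow> countable (B x)"
  assumes abs: "\<And>x. x \<in> A \<Longrightarrow> (\<lambda>y. norm (f x y)) summable_on B x"
  assumes sum: "\<And>x. x \<in> A \<Longrightarrow> (f x has_sum s x) (B x)"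
  shows "((\<lambda>g. \<Prod>x\<in>A. f x (g x)) has_sum (\<Prod>x\<in>A. s x)) (PiE A B)"
proof -
  have "(\<lambda>g. norm (\<Prod>x\<in>A. f x (g x))) summable_on PiE A B"
    unfolding abs_summable_equivalent
    by (rule abs_summable_on_prod_PiE) (use assms(1,2) abs in \<open>simp_all add: abs_summable_equivalent\<close>)
  then have "(\<lambda>g. \<Prod>x\<in>A. f x (g x)) summable_on PiE A B"
    by (rule abs_summable_summable)
  moreover have "(\<Sum>\<^sub>\<infinity>g\<in>PiE A B. \<Prod>x\<in>A. f x (g x)) = (\<Prod>x\<in>A. s x)"
    using infsum_prod_PiE_abs[of A f B] assms(1) abs infsumI[OF sum] by simp
  ultimately show ?thesis by (simp add: has_sum_iff)
qed

lemma has_sum_sum_finite: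
  fixes f :: "'a \<Rightarrow> 'b \<Rightarrow> 'c :: topological_comm_monoid_add"
  assumes "finite I" "\<And>i. i \<in> I \<Longrightarrow> (f i has_sum s i) A"
  shows "((\<lambda>x. \<Sum>i\<in>I. f i x) has_sum (\<Sum>i\<in>I. s i)) A"
  using assms by (induction I rule: finite_induct) (auto intro: has_sum_add)

section \<open>Uniqueness of power series coefficients\<close>

text \<open>Zeros of a nonzero power series are isolated, whereas here the sum vanishes on a whole
  disc.\<close>

lemma powser_has_sum_0_imp_coeff_0:
  fixes a :: "nat \<Rightarrow> complex"
  assumes "\<epsilon> > 0" and "\<And>x. norm x < \<epsilon> \<Longrightarrow> ((\<lambda>n. a n * x ^ n) has_sum 0) UNIV"
  shows "a n = 0"
proof (rule ccontr)
  assume n: "a n \<noteq> 0"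
  have sums: "(\<lambda>n. a n * x ^ n) sums 0" if "norm x < \<epsilon>" for x
    using assms(2)[OF that] by (rule has_sum_imp_sums)
  \<comment> \<open>\<open>powser_0_nonzero\<close> wants a nonzero coefficient of positive index,
    so the constant term is treated first.\<close>
  have "a 0 = 0"
    using sums[of 0] assms(1) powser_sums_zero[of a] sums_unique2 by fastforce
  with n have "n > 0" by (cases n) auto
  show False
  proof (rule powser_0_nonzero[of \<epsilon> 0 a "\<lambda>_. 0" n])
    fix s :: real
    assume "0 < s" "\<And>z::complex. z \<in> cball 0 s - {0} \<Longrightarrow> (0::complex) \<noteq> 0"
    from this(1) this(2)[of "of_real s"] show False by simp
  qed (use assms(1) n \<open>n > 0\<close> sums in auto)
qed

text \<open>Induction on the variables: with all but one of them fixed, the series is a power series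
  in the remaining one. Its coefficients vanish by the one-variable case, and they are themselves
  series in fewer variables.\<close>

lemma multi_powser_has_sum_0_imp_coeff_0:
  fixes d :: "('a \<Rightarrow> nat) \<Rightarrow> complex"
  assumes "finite S" "\<epsilon> > 0"
    and "\<And>x. (\<forall>j\<in>S. norm (x j) < \<epsilon>) \<Longrightarrow>
           ((\<lambda>m. d m * (\<Prod>j\<in>S. x j ^ m j)) has_sum 0) (S \<rightarrow>\<^sub>E UNIV)"
    and "m \<in> S \<rightarrow>\<^sub>E UNIV"
  shows "d m = 0"
  using assms(1,3,4)
proof (induction S arbitrary: d m rule: finite_induct)
  case empty
  then show ?case by (auto simp: has_sum_finite_iff)
next
  case (insert a S)
  define h where "h = (\<lambda>(n::nat, g). g(a := n))"
  have img: "insert a S \<rightarrow>\<^sub>E UNIV = h ` (UNIV \<times> (S \<rightarrow>\<^sub>E UNIV))"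
    unfolding h_def by (rule PiE_insert_eq)
  have inj: "inj_on h (UNIV \<times> (S \<rightarrow>\<^sub>E UNIV))"
    unfolding h_def using inj_combinator[of a S "\<lambda>_. UNIV"] insert.hyps by simp
  have prod_eq: "(\<Prod>j\<in>S. (x(a := w)) j ^ (g(a := n)) j) = (\<Prod>j\<in>S. x j ^ g j)"
    for x :: "'a \<Rightarrow> complex" and w g n
    using insert.hyps by (intro prod.cong) auto
  have sum0: "((\<lambda>(n, g). w ^ n * (d (g(a := n)) * (\<Prod>j\<in>S. x j ^ g j))) has_sum 0)
      (UNIV \<times> (S \<rightarrow>\<^sub>E UNIV))"
    if "\<forall>j\<in>S. norm (x j) < \<epsilon>" "norm w < \<epsilon>" for x w
  proof -
    have "((\<lambda>m. d m * (\<Prod>j\<in>insert a S. (x(a := w)) j ^ m j)) has_sum 0)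
            (insert a S \<rightarrow>\<^sub>E UNIV)"
      using insert.hyps that by (intro insert.prems(1)) auto
    then have "((\<lambda>p. d (h p) * (\<Prod>j\<in>insert a S. (x(a := w)) j ^ h p j)) has_sum 0)
            (UNIV \<times> (S \<rightarrow>\<^sub>E UNIV))"
      unfolding img has_sum_reindex[OF inj] by (simp add: o_def)
    also have "(\<lambda>p. d (h p) * (\<Prod>j\<in>insert a S. (x(a := w)) j ^ h p j)) =
        (\<lambda>(n, g). w ^ n * (d (g(a := n)) * (\<Prod>j\<in>S. x j ^ g j)))"
    proof (rule ext, clarify)
      fix n g
      have "(\<Prod>j\<in>insert a S. (x(a := w)) j ^ h (n, g) j) = w ^ n * (\<Prod>j\<in>S. x j ^ g j)"
        unfolding h_def prod.case prod.insert[OF insert.hyps] prod_eq fun_upd_same ..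
      then show "d (h (n, g)) * (\<Prod>j\<in>insert a S. (x(a := w)) j ^ h (n, g) j) =
          w ^ n * (d (g(a := n)) * (\<Prod>j\<in>S. x j ^ g j))"
        by (simp only: h_def prod.case mult.left_commute)
    qed
    finally show ?thesis .
  qed
  have coeff: "((\<lambda>g. d (g(a := n)) * (\<Prod>j\<in>S. x j ^ g j)) has_sum 0) (S \<rightarrow>\<^sub>E UNIV)"
    if x: "\<forall>j\<in>S. norm (x j) < \<epsilon>" for x n
  proof -
    define F where "F = (\<lambda>n g. d (g(a := n)) * (\<Prod>j\<in>S. x j ^ g j))"
    \<comment> \<open>Any nonzero point of the disc would do: the factor \<open>w ^ n\<close> must
      be cancelled to obtain summability of the slice \<open>F n\<close>.\<close>
    define w where "w = complex_of_real (\<epsilon> / 2)"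
    have w: "norm w < \<epsilon>" "w \<noteq> 0"
      using assms(2) by (auto simp: w_def)
    have sm: "F n summable_on (S \<rightarrow>\<^sub>E UNIV)" for n
    proof -
      have "(\<lambda>g. w ^ n * F n g) summable_on (S \<rightarrow>\<^sub>E UNIV)"
        by (rule summable_on_SigmaD1[where A = UNIV and B = "\<lambda>_. S \<rightarrow>\<^sub>E UNIV"])
           (use has_sum_imp_summable[OF sum0[OF x w(1)]] in \<open>simp_all add: F_def\<close>)
      then show ?thesis using w(2) by (simp add: summable_on_cmult_right')
    qed
    \<comment> \<open>Summing over \<open>g\<close> first leaves a one-variable power series in
      \<open>v\<close>.\<close>
    have "((\<lambda>n. infsum (F n) (S \<rightarrow>\<^sub>E UNIV) * v ^ n) has_sum 0) UNIV" if v: "norm v < \<epsilon>" for v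
    proof (rule has_sum_SigmaD[OF sum0[OF x v]])
      fix n
      show "((\<lambda>g. case (n, g) of (n, g) \<Rightarrow> v ^ n * (d (g(a := n)) * (\<Prod>j\<in>S. x j ^ g j)))
          has_sum infsum (F n) (S \<rightarrow>\<^sub>E UNIV) * v ^ n) (S \<rightarrow>\<^sub>E UNIV)"
        using has_sum_cmult_right[OF has_sum_infsum[OF sm[of n]], of "v ^ n"]
        by (simp add: F_def mult.commute)
    qed
    then have "infsum (F n) (S \<rightarrow>\<^sub>E UNIV) = 0" for n
      by (rule powser_has_sum_0_imp_coeff_0[OF assms(2)])
    with sm[of n] show ?thesis by (simp add: has_sum_iff F_def)
  qed
  from insert.prems(2) obtain n g where m: "m = g(a := n)" "g \<in> S \<rightarrow>\<^sub>E UNIV"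
    unfolding img h_def by auto
  show ?case
    unfolding m(1) by (rule insert.IH[OF coeff m(2)]) 
qed

section \<open>Binomial series and binomial inversion\<close>

text \<open>Up to the factor \<open>z ^ p\<close> and an index shift by \<open>p\<close>, this is
  the binomial series of \<open>1 - z\<close> with exponent \<open>- Suc p\<close>.\<close>

lemma has_sum_choose_power:
  fixes z :: complex
  assumes "norm z < 1"
  shows "((\<lambda>n. of_nat (n choose p) * z ^ n) has_sum z ^ p / (1 - z) ^ Suc p) UNIV"
    and "(\<lambda>n. norm (of_nat (n choose p) * z ^ n)) summable_on UNIV"
proof -
  have sums: "(\<lambda>n. of_nat (n choose p) * z ^ n) sums (z ^ p / (1 - z) ^ Suc p)"
    if z: "norm z < 1" for z :: complex
  proof -
    have "(1 - z) \<noteq> 0" using z by auto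
    have "((- of_nat (Suc p)) gchoose n) * (- z) ^ n = of_nat ((n + p) choose p) * z ^ n" for n
    proof -
      have "((- of_nat (Suc p)) gchoose n) * (- z) ^ n =
          (-1) ^ n * (-z) ^ n * (of_nat (n + p) gchoose n)"
        by (subst gbinomial_minus) (simp add: algebra_simps)
      also have "(-1) ^ n * (-z) ^ n = z ^ n"
        by (simp flip: power_mult_distrib)
      also have "(of_nat (n + p) gchoose n :: complex) = of_nat ((n + p) choose p)"
        using binomial_symmetric[of n "n + p"] by (simp flip: binomial_gbinomial del: of_nat_add)
      finally show ?thesis by simp
    qed
    then have "(\<lambda>n. of_nat ((n + p) choose p) * z ^ n) sums (1 - z) powr (- of_nat (Suc p))"
      using gen_binomial_complex[of "- z" "- of_nat (Suc p)"] z by simp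
    also have "(1 - z) powr (- of_nat (Suc p)) = 1 / (1 - z) ^ Suc p"
      unfolding powr_minus using powr_nat'[of "1 - z" "Suc p"] \<open>1 - z \<noteq> 0\<close> by (simp only: inverse_eq_divide) auto
    finally have "(\<lambda>n. z ^ p * (of_nat ((n + p) choose p) * z ^ n)) sums (z ^ p * (1 / (1 - z) ^ Suc p))"
      by (rule sums_mult)
    then have "(\<lambda>n. of_nat ((n + p) choose p) * z ^ (n + p)) sums (z ^ p / (1 - z) ^ Suc p)"
      by (simp add: power_add mult_ac)
    \<comment> \<open>The shift by \<open>p\<close> is undone at no cost, since
      \<open>n choose p\<close> is \<open>0\<close> for \<open>n < p\<close>.\<close>
    then show ?thesis
      by (subst (asm) sums_zero_iff_shift) (auto simp: binomial_eq_0)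
  qed
  \<comment> \<open>Convergence at a real point \<open>t\<close> strictly between
    \<open>norm z\<close> and \<open>1\<close> gives absolute convergence at
    \<open>z\<close>.\<close>
  obtain t where t: "norm z < t" "t < 1" using dense[OF assms] by blast
  have "t > 0" using t(1) norm_ge_zero[of z] by linarith
  have "summable (\<lambda>n. norm (of_nat (n choose p) * z ^ n))"
    by (rule powser_insidea[where x = "of_real t"])
       (use t \<open>t > 0\<close> in \<open>auto intro!: sums_summable[OF sums]\<close>)
  then show "((\<lambda>n. of_nat (n choose p) * z ^ n) has_sum z ^ p / (1 - z) ^ Suc p) UNIV"
    and "(\<lambda>n. norm (of_nat (n choose p) * z ^ n)) summable_on UNIV"
    using sums[OF assms] by (auto intro: norm_summable_imp_has_sum norm_summable_imp_summable_on)
qed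

text \<open>Since \<open>(n choose i) * (i choose p)\<close> equals
  \<open>(n choose p) * ((n - p) choose (i - p))\<close>, the sum is a multiple of
  \<open>(1 - 1) ^ (n - p)\<close>, where \<open>0 ^ 0 = 1\<close> covers
  \<open>n = p\<close>.\<close>

lemma alternating_sum_choose_choose:
  "(\<Sum>i\<le>n. (-1) ^ (n - i) * of_nat (n choose i) * of_nat (i choose p) :: 'a :: comm_ring_1) =
     of_bool (n = p)"
proof (cases "p \<le> n")
  case True
  have "(\<Sum>i\<le>n. (-1) ^ (n - i) * of_nat (n choose i) * of_nat (i choose p) :: 'a) =
     (\<Sum>i=p..n. (-1) ^ (n - i) * of_nat (n choose i) * of_nat (i choose p))"
    by (rule sum.mono_neutral_right) (auto simp: binomial_eq_0)
  also have "\<dots> = (\<Sum>i=p..n. of_nat (n choose p) * ((-1) ^ (n - i) * of_nat ((n - p) choose (i - p))))"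
  proof (rule sum.cong)
    fix i assume "i \<in> {p..n}"
    then have "of_nat (n choose i) * of_nat (i choose p) =
        (of_nat (n choose p) * of_nat ((n - p) choose (i - p)) :: 'a)"
      by (simp add: choose_mult flip: of_nat_mult)
    then show "(-1) ^ (n - i) * of_nat (n choose i) * of_nat (i choose p) =
        (of_nat (n choose p) * ((-1) ^ (n - i) * of_nat ((n - p) choose (i - p))) :: 'a)"
      by (simp only: mult.assoc mult.left_commute[of _ "(-1) ^ (n - i)"])
  qed simp
  also have "\<dots> = of_nat (n choose p) * (\<Sum>j\<le>n-p. (-1) ^ (n - p - j) * of_nat ((n - p) choose j))"
    unfolding sum_distrib_left
    by (rule sum.reindex_bij_witness[of _ "\<lambda>j. j + p" "\<lambda>i. i - p"]) (use True in auto)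
  also have "(\<Sum>j\<le>n-p. (-1) ^ (n - p - j) * of_nat ((n - p) choose j) :: 'a) = 0 ^ (n - p)"
    using binomial_ring[of "1::'a" "-1" "n - p"] by (simp add: mult.commute)
  finally show ?thesis using True by (auto simp: power_0_left)
qed (auto simp: binomial_eq_0 intro!: sum.neutral)

section \<open>Newton expansions in several variables\<close>

definition newton_basis :: "'a set \<Rightarrow> ('a \<Rightarrow> nat) \<Rightarrow> ('a \<Rightarrow> nat) \<Rightarrow> complex" where
  "newton_basis S p l = (\<Prod>j\<in>S. of_nat ((l j - 1) choose p j))"

text \<open>Only the existence of coefficients is recorded, which keeps the closure properties
  simple; \<open>newton_expansion\<close> identifies them later. Points with a coordinate
  \<open>0\<close> are left out because \<open>l j - 1\<close> truncates there.\<close>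

definition newton_expandable :: "'a set \<Rightarrow> (('a \<Rightarrow> nat) \<Rightarrow> complex) \<Rightarrow> bool" where
  "newton_expandable S f \<longleftrightarrow>
     (\<exists>P a. finite P \<and> P \<subseteq> S \<rightarrow>\<^sub>E UNIV \<and>
        (\<forall>l. (\<forall>j\<in>S. 1 \<le> l j) \<longrightarrow> f l = (\<Sum>p\<in>P. a p * newton_basis S p l)))"

lemma newton_expandable_scaled_basis:
  "p \<in> S \<rightarrow>\<^sub>E UNIV \<Longrightarrow> newton_expandable S (\<lambda>l. c * newton_basis S p l)"
  unfolding newton_expandable_def
  by (rule exI[of _ "{p}"], rule exI[of _ "\<lambda>_. c"]) auto

lemma newton_expandable_add:
  assumes "newton_expandable S f" "newton_expandable S g"
  shows "newton_expandable S (\<lambda>l. f l + g l)"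
proof -
  obtain P a where P: "finite P" "P \<subseteq> S \<rightarrow>\<^sub>E UNIV"
      "\<And>l. \<forall>j\<in>S. 1 \<le> l j \<Longrightarrow> f l = (\<Sum>p\<in>P. a p * newton_basis S p l)"
    using assms(1) unfolding newton_expandable_def by blast
  obtain Q b where Q: "finite Q" "Q \<subseteq> S \<rightarrow>\<^sub>E UNIV"
      "\<And>l. \<forall>j\<in>S. 1 \<le> l j \<Longrightarrow> g l = (\<Sum>p\<in>Q. b p * newton_basis S p l)"
    using assms(2) unfolding newton_expandable_def by blast
  define c where "c p = (if p \<in> P then a p else 0) + (if p \<in> Q then b p else 0)" for p
  have "f l + g l = (\<Sum>p\<in>P \<union> Q. c p * newton_basis S p l)" if l: "\<forall>j\<in>S. 1 \<le> l j" for l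
  proof -
    have "f l = (\<Sum>p\<in>P \<union> Q. (if p \<in> P then a p else 0) * newton_basis S p l)"
      unfolding P(3)[OF l] using P(1) Q(1) by (intro sum.mono_neutral_cong_left) auto
    moreover have "g l = (\<Sum>p\<in>P \<union> Q. (if p \<in> Q then b p else 0) * newton_basis S p l)"
      unfolding Q(3)[OF l] using P(1) Q(1) by (intro sum.mono_neutral_cong_left) auto
    ultimately show ?thesis
      by (simp add: c_def distrib_right sum.distrib)
  qed
  then show ?thesis
    unfolding newton_expandable_def using P(1,2) Q(1,2)
    by (intro exI[of _ "P \<union> Q"] exI[of _ c]) auto
qed

lemma newton_expandable_sum:
  assumes "finite I" "\<And>i. i \<in> I \<Longrightarrow> newton_expandable S (f i)"
  shows "newton_expandable S (\<lambda>l. \<Sum>i\<in>I. f i l)"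
  using assms
proof (induction I rule: finite_induct)
  case empty
  show ?case
    unfolding newton_expandable_def by (rule exI[of _ "{}"]) auto
next
  case (insert i I)
  then have "newton_expandable S (\<lambda>l. f i l + (\<Sum>i\<in>I. f i l))"
    by (intro newton_expandable_add) simp_all
  then show ?case using insert.hyps by simp
qed

lemma newton_expandable_cong:
  assumes "newton_expandable S f" "\<And>l. \<forall>j\<in>S. 1 \<le> l j \<Longrightarrow> g l = f l"
  shows "newton_expandable S g"
proof -
  obtain P a where "finite P" "P \<subseteq> S \<rightarrow>\<^sub>E UNIV"
      "\<And>l. \<forall>j\<in>S. 1 \<le> l j \<Longrightarrow> f l = (\<Sum>p\<in>P. a p * newton_basis S p l)"
    using assms(1) unfolding newton_expandable_def by blast
  then show ?thesis
    unfolding newton_expandable_def using assms(2)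
    by (intro exI[of _ P] exI[of _ a]) simp
qed

text \<open>With \<open>i = l j - 1\<close>, absorption turns \<open>Suc i * (i choose n)\<close>
  into \<open>Suc n * (Suc i choose Suc n)\<close>, which Pascal's rule splits. Hence multiplication
  by a variable preserves the span of the basis.\<close>

lemma newton_basis_mult_var:
  assumes "finite S" "j \<in> S" "1 \<le> l j"
  shows "of_nat (l j) * newton_basis S p l =
      of_nat (Suc (p j)) * newton_basis S p l +
      of_nat (Suc (p j)) * newton_basis S (p(j := Suc (p j))) l"
proof -
  define R where "R = (\<Prod>i\<in>S - {j}. of_nat ((l i - 1) choose p i) :: complex)"
  have "of_nat (Suc i) * (of_nat (i choose n) :: complex) =
      of_nat (Suc n) * of_nat (i choose n) + of_nat (Suc n) * of_nat (i choose Suc n)" for i n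
  proof -
    have "Suc i * (i choose n) = Suc n * (i choose n) + Suc n * (i choose Suc n)"
      using Suc_times_binomial_eq[of i n] by (simp add: algebra_simps)
    then show ?thesis by (metis of_nat_mult of_nat_add)
  qed
  from this[of "l j - 1" "p j"] assms(3)
  have *: "of_nat (l j) * (of_nat ((l j - 1) choose p j) :: complex) =
      of_nat (Suc (p j)) * of_nat ((l j - 1) choose p j) +
      of_nat (Suc (p j)) * of_nat ((l j - 1) choose Suc (p j))"
    by simp
  have 1: "newton_basis S p l = of_nat ((l j - 1) choose p j) * R"
    unfolding newton_basis_def R_def using assms(1,2) by (rule prod.remove)
  have 2: "newton_basis S (p(j := Suc (p j))) l = of_nat ((l j - 1) choose Suc (p j)) * R"
    unfolding newton_basis_def R_def by (subst prod.remove[OF assms(1,2)]) simp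
  have "of_nat (l j) * newton_basis S p l = (of_nat (l j) * of_nat ((l j - 1) choose p j)) * R"
    unfolding 1 by (simp only: mult.assoc)
  then show ?thesis
    unfolding * by (simp only: 1 2 distrib_right mult.assoc)
qed

lemma newton_expandable_mult_var:
  assumes "finite S" "j \<in> S" "newton_expandable S f"
  shows "newton_expandable S (\<lambda>l. of_nat (l j) * f l)"
proof -
  obtain P a where P: "finite P" "P \<subseteq> S \<rightarrow>\<^sub>E UNIV"
      "\<And>l. \<forall>j\<in>S. 1 \<le> l j \<Longrightarrow> f l = (\<Sum>p\<in>P. a p * newton_basis S p l)"
    using assms(3) unfolding newton_expandable_def by blast
  have "newton_expandable S (\<lambda>l. \<Sum>p\<in>P. (a p * of_nat (Suc (p j))) * newton_basis S p l +
      (a p * of_nat (Suc (p j))) * newton_basis S (p(j := Suc (p j))) l)"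
    using P(1,2) assms(2)
    by (intro newton_expandable_sum newton_expandable_add newton_expandable_scaled_basis)
       (auto simp: PiE_iff extensional_def)
  then show ?thesis
  proof (rule newton_expandable_cong)
    fix l :: "'a \<Rightarrow> nat" assume l: "\<forall>j\<in>S. 1 \<le> l j"
    have "a p * (of_nat (l j) * newton_basis S p l) =
        (a p * of_nat (Suc (p j))) * newton_basis S p l +
        (a p * of_nat (Suc (p j))) * newton_basis S (p(j := Suc (p j))) l" for p
      using newton_basis_mult_var[of S j l p] assms(1,2) l
      by (simp only: distrib_left mult.assoc)
    then show "of_nat (l j) * f l =
        (\<Sum>p\<in>P. (a p * of_nat (Suc (p j))) * newton_basis S p l +
        (a p * of_nat (Suc (p j))) * newton_basis S (p(j := Suc (p j))) l)"
      unfolding P(3)[OF l] sum_distrib_left by (simp only: mult.left_commute)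
  qed
qed

text \<open>Each factor is a sum of variables, so the product is built up by multiplying with one
  variable at a time and adding. Keeping \<open>J\<close> apart from \<open>S\<close> lets the
  induction remove factors without changing the set of variables.\<close>

lemma newton_expandable_prod_sum_power:
  assumes "finite S" "finite J" "\<And>j. j \<in> J \<Longrightarrow> T j \<subseteq> S"
  shows "newton_expandable S (\<lambda>l. \<Prod>j\<in>J. of_nat (\<Sum>i\<in>T j. l i) ^ k j)"
  using assms(2,3)
proof (induction J rule: finite_induct)
  case empty
  have "newton_expandable S (\<lambda>l. 1 * newton_basis S (\<lambda>j\<in>S. 0) l)"
    by (intro newton_expandable_scaled_basis) auto
  then show ?case by (simp add: newton_basis_def)
next
  case (insert j J)
  have "newton_expandable S (\<lambda>l. of_nat (\<Sum>i\<in>T j. l i) ^ n * (\<Prod>j\<in>J. of_nat (\<Sum>i\<in>T j. l i) ^ k j))" for n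
  proof (induction n)
    case 0
    then show ?case using insert by simp
  next
    case (Suc n)
    have "newton_expandable S (\<lambda>l. \<Sum>i\<in>T j. of_nat (l i) *
        (of_nat (\<Sum>i\<in>T j. l i) ^ n * (\<Prod>j\<in>J. of_nat (\<Sum>i\<in>T j. l i) ^ k j)))"
      using insert.prems[of j] assms(1)
      by (intro newton_expandable_sum newton_expandable_mult_var Suc) (auto intro: finite_subset)
    then show ?case
      by (simp add: sum_distrib_right mult.assoc)
  qed
  then show ?case using insert.hyps by simp
qed

section \<open>Iterated finite differences\<close>

text \<open>
  Every coordinate starts at \<open>1\<close>, so the difference at \<open>n\<close> samples the points
  \<open>1, \<dots>, n j + 1\<close> in coordinate \<open>j\<close>.
\<close>

definition diff_coeff :: "nat \<Rightarrow> nat \<Rightarrow> complex" where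
  "diff_coeff n l = (-1) ^ (Suc n - l) * of_nat (n choose (l - 1))"

definition finite_diff :: "'a set \<Rightarrow> ('a \<Rightarrow> nat) \<Rightarrow> (('a \<Rightarrow> nat) \<Rightarrow> complex) \<Rightarrow> complex" where
  "finite_diff S n f =
     (\<Sum>l\<in>PiE S (\<lambda>j. {1..Suc (n j)}). (\<Prod>j\<in>S. diff_coeff (n j) (l j)) * f l)"

lemma sum_diff_coeff_choose:
  "(\<Sum>l=1..Suc n. diff_coeff n l * of_nat ((l - 1) choose p)) = of_bool (n = p)"
proof -
  have "(\<Sum>l=1..Suc n. diff_coeff n l * of_nat ((l - 1) choose p)) =
      (\<Sum>i\<le>n. (-1) ^ (n - i) * of_nat (n choose i) * of_nat (i choose p))"
    by (rule sum.reindex_bij_witness[of _ Suc "\<lambda>l. l - 1"])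
       (auto simp: diff_coeff_def Suc_diff_le)
  then show ?thesis by (simp only: alternating_sum_choose_choose)
qed

text \<open>This is the binomial theorem for \<open>u + (-1)\<close>; the extra factor
  \<open>u\<close> arises because \<open>l\<close> starts at \<open>1\<close>.\<close>

lemma sum_diff_coeff_power:
  "(\<Sum>l=1..Suc n. diff_coeff n l * u ^ l) = u * (u - 1) ^ n"
proof -
  have "(\<Sum>l=1..Suc n. diff_coeff n l * u ^ l) =
      (\<Sum>i\<le>n. u * (of_nat (n choose i) * u ^ i * (-1) ^ (n - i)))"
    by (rule sum.reindex_bij_witness[of _ Suc "\<lambda>l. l - 1"])
       (auto simp: diff_coeff_def Suc_diff_le mult_ac simp flip: power_Suc)
  then show ?thesis
    using binomial_ring[of u "-1" n] by (simp add: sum_distrib_left)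
qed

text \<open>The difference factors over the coordinates, and each factor is a Kronecker delta by
  binomial inversion. Extensionality makes coordinatewise agreement on \<open>S\<close> the same as
  \<open>n = p\<close>.\<close>

lemma finite_diff_newton_basis:
  assumes "finite S" "n \<in> S \<rightarrow>\<^sub>E UNIV" "p \<in> S \<rightarrow>\<^sub>E UNIV"
  shows "finite_diff S n (newton_basis S p) = of_bool (n = p)"
proof -
  have "finite_diff S n (newton_basis S p) =
      (\<Prod>j\<in>S. \<Sum>l=1..Suc (n j). diff_coeff (n j) l * of_nat ((l - 1) choose p j))"
    unfolding finite_diff_def newton_basis_def using assms(1)
    by (subst prod_sum_PiE) (auto simp: prod.distrib)
  also have "\<dots> = (\<Prod>j\<in>S. of_bool (n j = p j))"
    by (simp only: sum_diff_coeff_choose)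
  also have "\<dots> = of_bool (n = p)"
    using assms by (auto simp: PiE_ext intro: PiE_ext)
  finally show ?thesis .
qed

text \<open>Taking differences of any expansion isolates its coefficients by duality. The vanishing
  outside \<open>P\<close> later allows the index sets for two different functions to be
  exchanged.\<close>

lemma newton_expansion:
  assumes "finite S" "newton_expandable S f"
  obtains P where "finite P" "P \<subseteq> S \<rightarrow>\<^sub>E UNIV"
    and "\<And>l. \<forall>j\<in>S. 1 \<le> l j \<Longrightarrow> f l = (\<Sum>p\<in>P. finite_diff S p f * newton_basis S p l)"
    and "\<And>p. p \<in> (S \<rightarrow>\<^sub>E UNIV) - P \<Longrightarrow> finite_diff S p f = 0"
proof -
  obtain P a where P: "finite P" "P \<subseteq> S \<rightarrow>\<^sub>E UNIV"
      "\<And>l. \<forall>j\<in>S. 1 \<le> l j \<Longrightarrow> f l = (\<Sum>p\<in>P. a p * newton_basis S p l)"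
    using assms(2) unfolding newton_expandable_def by blast
  have diff: "finite_diff S n f = (if n \<in> P then a n else 0)" if n: "n \<in> S \<rightarrow>\<^sub>E UNIV" for n
  proof -
    have "finite_diff S n f = finite_diff S n (\<lambda>l. \<Sum>p\<in>P. a p * newton_basis S p l)"
      \<comment> \<open>The sample points have all coordinates at least \<open>1\<close>, where the
        expansion is valid.\<close>
      unfolding finite_diff_def
      by (intro sum.cong refl arg_cong2[where f = "(*)"] P(3)) (auto simp: PiE_iff)
    also have "\<dots> = (\<Sum>p\<in>P. a p * finite_diff S n (newton_basis S p))"
      unfolding finite_diff_def sum_distrib_left by (subst sum.swap) (simp add: mult_ac)
    also have "\<dots> = (\<Sum>p\<in>P. if n = p then a p else 0)"
      using finite_diff_newton_basis[OF assms(1) n] P(2) by (intro sum.cong) auto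
    finally show ?thesis using P(1) by simp
  qed
  show ?thesis
  proof
    show "f l = (\<Sum>p\<in>P. finite_diff S p f * newton_basis S p l)" if "\<forall>j\<in>S. 1 \<le> l j" for l
      unfolding P(3)[OF that] using diff P(2) by (intro sum.cong) auto
  qed (use P diff in auto)
qed

section \<open>Summation over \<open>l\<close>\<close>

text \<open>It plays two roles: for \<open>k\<close> it is the reciprocal of the denominator at
  \<open>s j = - k j\<close>, and for fixed \<open>l\<close> its values at \<open>m\<close> are the
  Taylor coefficients of a product of exponentials.\<close>

definition partial_sum_powers :: "nat \<Rightarrow> (nat \<Rightarrow> nat) \<Rightarrow> (nat \<Rightarrow> nat) \<Rightarrow> complex" where
  "partial_sum_powers r k l = (\<Prod>j=1..r. of_nat (\<Sum>i=1..j. l i) ^ k j)"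

text \<open>This is the quantity \<open>D p k\<close> of the overview.\<close>

abbreviation bern_diff :: "nat \<Rightarrow> (nat \<Rightarrow> nat) \<Rightarrow> (nat \<Rightarrow> nat) \<Rightarrow> complex" where
  "bern_diff r k p \<equiv> finite_diff {1..r} p (partial_sum_powers r k)"

lemma newton_expandable_partial_sum_powers:
  "newton_expandable {1..r} (partial_sum_powers r k)"
  unfolding partial_sum_powers_def by (intro newton_expandable_prod_sum_power) auto

lemma has_sum_newton_basis:
  fixes z :: "'a \<Rightarrow> complex"
  assumes "finite S" "\<And>j. j \<in> S \<Longrightarrow> norm (z j) < 1"
  shows "((\<lambda>l. (\<Prod>j\<in>S. z j ^ (l j - 1)) * newton_basis S p l)
           has_sum (\<Prod>j\<in>S. z j ^ p j / (1 - z j) ^ Suc (p j))) (S \<rightarrow>\<^sub>E {1..})"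
proof -
  have "((\<lambda>l. \<Prod>j\<in>S. of_nat ((l j - 1) choose p j) * z j ^ (l j - 1))
      has_sum (\<Prod>j\<in>S. z j ^ p j / (1 - z j) ^ Suc (p j))) (S \<rightarrow>\<^sub>E {1..})"
  proof (rule has_sum_prod_PiE_abs[where f = "\<lambda>j n. of_nat ((n - 1) choose p j) * z j ^ (n - 1)"])
    fix j assume "j \<in> S"
    \<comment> \<open>The value type is left general because both the complex series and the real
      series of norms are shifted.\<close>
    have Suc: "(g has_sum s) {1..} \<longleftrightarrow> ((\<lambda>n. g (Suc n)) has_sum s) UNIV"
      for g :: "nat \<Rightarrow> 'b :: {topological_comm_monoid_add, t2_space}" and s
      by (rule has_sum_reindex_bij_witness[of _ Suc "\<lambda>n. n - 1"]) auto
    show "((\<lambda>n. of_nat ((n - 1) choose p j) * z j ^ (n - 1)) has_sum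
        z j ^ p j / (1 - z j) ^ Suc (p j)) {1..}"
      unfolding Suc using has_sum_choose_power(1)[OF assms(2)[OF \<open>j \<in> S\<close>]] by simp
    show "(\<lambda>n. norm (of_nat ((n - 1) choose p j) * z j ^ (n - 1))) summable_on {1..}"
      unfolding summable_on_def Suc
      using has_sum_choose_power(2)[OF assms(2)[OF \<open>j \<in> S\<close>]] by (simp add: summable_on_def)
  qed (use assms(1) in auto)
  then show ?thesis
    by (simp add: prod.distrib newton_basis_def mult.commute)
qed

text \<open>The Newton expansion is finite, so the sum over \<open>l\<close> may be taken separately
  for each basis function, where \<open>has_sum_newton_basis\<close> evaluates it.\<close>

lemma bern_gen_neg_nat:
  assumes "\<And>j. j \<in> {1..r} \<Longrightarrow> norm (1 - exp (- tail_sum r x j)) < 1"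
    and "finite P"
    and newton: "\<And>l. \<forall>j\<in>{1..r}. 1 \<le> l j \<Longrightarrow>
      partial_sum_powers r k l = (\<Sum>p\<in>P. bern_diff r k p * newton_basis {1..r} p l)"
  shows "bern_gen r (\<lambda>j. - of_nat (k j)) x =
    (\<Sum>p\<in>P. bern_diff r k p *
       (\<Prod>j=1..r. exp (tail_sum r x j) * (exp (tail_sum r x j) - 1) ^ p j))"
proof -
  define z where "z j = 1 - exp (- tail_sum r x j)" for j
  \<comment> \<open>With \<open>u = exp (tail_sum r x j)\<close> one has
    \<open>z j = 1 - 1 / u\<close>, so \<open>z j / (1 - z j) = u - 1\<close> and
    \<open>1 / (1 - z j) = u\<close>.\<close>
  have frac: "z j ^ n / (1 - z j) ^ Suc n = exp (tail_sum r x j) * (exp (tail_sum r x j) - 1) ^ n"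
    for j n
  proof -
    have "z j / (1 - z j) = exp (tail_sum r x j) - 1" "1 / (1 - z j) = exp (tail_sum r x j)"
      by (simp_all add: z_def exp_minus field_simps)
    then show ?thesis by (metis (no_types) power_Suc power_divide times_divide_times_eq mult_1)
  qed
  have powers: "(\<Prod>j=1..r. z j ^ (l j - 1)) / (\<Prod>j=1..r. of_nat (\<Sum>i=1..j. l i) powr (- of_nat (k j))) =
      (\<Sum>p\<in>P. bern_diff r k p * ((\<Prod>j=1..r. z j ^ (l j - 1)) * newton_basis {1..r} p l))"
    if l: "l \<in> {1..r} \<rightarrow>\<^sub>E {1..}" for l
  proof -
    have l1: "\<forall>j\<in>{1..r}. 1 \<le> l j" using l by (auto simp: PiE_iff)
    \<comment> \<open>The exponent \<open>k j\<close> may be \<open>0\<close>, and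
      \<open>0 powr 0\<close> is \<open>0\<close> while \<open>0 ^ 0\<close> is \<open>1\<close>;
      hence the base is first shown to be nonzero.\<close>
    have "(of_nat (\<Sum>i=1..j. l i) :: complex) powr (- of_nat (k j)) =
        inverse (of_nat (\<Sum>i=1..j. l i) ^ k j)" if j: "j \<in> {1..r}" for j
    proof -
      have "1 \<le> l j" using l1 j by auto
      also have "l j \<le> (\<Sum>i=1..j. l i)" using j by (intro member_le_sum) auto
      finally have "of_nat (\<Sum>i=1..j. l i) \<noteq> (0 :: complex)" by (simp only: of_nat_eq_0_iff)
      then show ?thesis by (simp only: powr_minus powr_nat') simp
    qed
    then have "(\<Prod>j=1..r. of_nat (\<Sum>i=1..j. l i) powr (- of_nat (k j))) = inverse (partial_sum_powers r k l)"
      unfolding partial_sum_powers_def prod_inversef[symmetric] o_def by (intro prod.cong) auto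
    then show ?thesis
      using newton[OF l1] by (simp add: sum_distrib_left divide_inverse mult_ac)
  qed
  have "((\<lambda>l. \<Sum>p\<in>P. bern_diff r k p * ((\<Prod>j=1..r. z j ^ (l j - 1)) * newton_basis {1..r} p l))
      has_sum (\<Sum>p\<in>P. bern_diff r k p * (\<Prod>j=1..r. z j ^ p j / (1 - z j) ^ Suc (p j))))
      ({1..r} \<rightarrow>\<^sub>E {1..})"
    using assms(1,2) by (intro has_sum_sum_finite has_sum_cmult_right has_sum_newton_basis) (auto simp: z_def)
  then have "bern_gen r (\<lambda>j. - of_nat (k j)) x =
      (\<Sum>p\<in>P. bern_diff r k p * (\<Prod>j=1..r. z j ^ p j / (1 - z j) ^ Suc (p j)))"
    unfolding bern_gen_def z_def[symmetric]
    by (subst infsum_cong[OF powers]) (auto dest: infsumI)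
  then show ?thesis by (simp only: frac)
qed

section \<open>Taylor expansion in \<open>x\<close>\<close>

text \<open>Both sides sum \<open>l j * x i\<close> over the pairs \<open>j \<le> i\<close>. This
  exchange links the tail sums of \<open>x\<close> to the partial sums of \<open>l\<close>.\<close>

lemma sum_tail_sum_mult:
  "(\<Sum>j=1..r. of_nat (l j) * tail_sum r x j) = (\<Sum>j=1..r. of_nat (\<Sum>i=1..j. l i) * x j)"
proof -
  have "(\<Sum>j=1..r. of_nat (l j) * tail_sum r x j) = (\<Sum>j=1..r. \<Sum>i=j..r. of_nat (l j) * x i)"
    by (simp add: tail_sum_def sum_distrib_left)
  also have "\<dots> = (\<Sum>i=1..r. \<Sum>j=1..i. of_nat (l j) * x i)"
    by (subst (1 2) sum.Sigma) (auto intro!: sum.reindex_bij_witness[of _ prod.swap prod.swap])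
  finally show ?thesis by (simp add: sum_distrib_right)
qed

text \<open>After \<open>sum_tail_sum_mult\<close> the variables \<open>x j\<close> separate, and
  the expansion is a product of exponential series, valid for every \<open>x\<close>.\<close>

lemma has_sum_prod_exp_tail_sum:
  "((\<lambda>m. partial_sum_powers r m l * ((\<Prod>j=1..r. x j ^ m j) / (\<Prod>j=1..r. fact (m j))))
     has_sum (\<Prod>j=1..r. exp (tail_sum r x j) ^ l j)) ({1..r} \<rightarrow>\<^sub>E UNIV)"
proof -
  define L where "L j = complex_of_nat (\<Sum>i=1..j. l i)" for j
  have "((\<lambda>m. \<Prod>j=1..r. (L j * x j) ^ m j / fact (m j)) has_sum (\<Prod>j=1..r. exp (L j * x j)))
     ({1..r} \<rightarrow>\<^sub>E UNIV)"
  proof (rule has_sum_prod_PiE_abs[where f = "\<lambda>j n. (L j * x j) ^ n / fact n"])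
    fix j
    have norm: "summable (\<lambda>n. norm ((L j * x j) ^ n / fact n))"
      using summable_norm_exp[of "L j * x j"] by (simp add: scaleR_conv_of_real field_simps norm_divide norm_power norm_mult)
    then show "(\<lambda>n. norm ((L j * x j) ^ n / fact n)) summable_on UNIV"
      by (rule norm_summable_imp_summable_on[where f = "\<lambda>n. norm ((L j * x j) ^ n / fact n)", simplified])
    have "(\<lambda>n. (L j * x j) ^ n / fact n) sums exp (L j * x j)"
      using exp_converges[of "L j * x j"] by (simp add: scaleR_conv_of_real field_simps)
    with norm show "((\<lambda>n. (L j * x j) ^ n / fact n) has_sum exp (L j * x j)) UNIV"
      by (rule norm_summable_imp_has_sum)
  qed auto
  moreover have "(\<Prod>j=1..r. exp (L j * x j)) = (\<Prod>j=1..r. exp (tail_sum r x j) ^ l j)"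
  proof -
    have "(\<Prod>j=1..r. exp (L j * x j)) = exp (\<Sum>j=1..r. L j * x j)" by (simp add: exp_sum)
    also have "(\<Sum>j=1..r. L j * x j) = (\<Sum>j=1..r. of_nat (l j) * tail_sum r x j)"
      unfolding sum_tail_sum_mult L_def ..
    finally show ?thesis by (simp add: exp_sum exp_of_nat_mult)
  qed
  moreover have "(\<Prod>j=1..r. (L j * x j) ^ m j / fact (m j)) =
      partial_sum_powers r m l * ((\<Prod>j=1..r. x j ^ m j) / (\<Prod>j=1..r. fact (m j)))" for m
    unfolding partial_sum_powers_def L_def by (simp add: power_mult_distrib prod.distrib prod_dividef)
  ultimately show ?thesis by simp
qed

text \<open>Both sides of \<open>has_sum_prod_exp_tail_sum\<close> are differenced in
  \<open>l\<close>; on the exponentials the difference factors and is given by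
  \<open>sum_diff_coeff_power\<close>.\<close>

lemma has_sum_prod_exp_power:
  "((\<lambda>m. bern_diff r m p * ((\<Prod>j=1..r. x j ^ m j) / (\<Prod>j=1..r. fact (m j))))
     has_sum (\<Prod>j=1..r. exp (tail_sum r x j) * (exp (tail_sum r x j) - 1) ^ p j))
     ({1..r} \<rightarrow>\<^sub>E UNIV)"
proof -
  have "((\<lambda>m. \<Sum>l\<in>PiE {1..r} (\<lambda>j. {1..Suc (p j)}). (\<Prod>j=1..r. diff_coeff (p j) (l j)) *
        (partial_sum_powers r m l * ((\<Prod>j=1..r. x j ^ m j) / (\<Prod>j=1..r. fact (m j)))))
      has_sum (\<Sum>l\<in>PiE {1..r} (\<lambda>j. {1..Suc (p j)}). (\<Prod>j=1..r. diff_coeff (p j) (l j)) *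
        (\<Prod>j=1..r. exp (tail_sum r x j) ^ l j))) ({1..r} \<rightarrow>\<^sub>E UNIV)"
    by (intro has_sum_sum_finite has_sum_cmult_right has_sum_prod_exp_tail_sum finite_PiE) auto
  also have "(\<Sum>l\<in>PiE {1..r} (\<lambda>j. {1..Suc (p j)}). (\<Prod>j=1..r. diff_coeff (p j) (l j)) *
        (\<Prod>j=1..r. exp (tail_sum r x j) ^ l j)) =
      (\<Prod>j=1..r. \<Sum>l=1..Suc (p j). diff_coeff (p j) l * exp (tail_sum r x j) ^ l)"
    by (subst prod_sum_PiE) (auto simp: prod.distrib)
  also have "\<dots> = (\<Prod>j=1..r. exp (tail_sum r x j) * (exp (tail_sum r x j) - 1) ^ p j)"
    by (simp only: sum_diff_coeff_power)
  finally show ?thesis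
    unfolding finite_diff_def sum_distrib_right mult.assoc .
qed

section \<open>Existence and uniqueness of the expansion at the origin\<close>

lemma tail_sum_near_0:
  obtains \<epsilon> where "\<epsilon> > 0"
    and "\<And>x j. \<forall>j\<in>{1..r}. norm (x j) < \<epsilon> \<Longrightarrow> j \<in> {1..r} \<Longrightarrow>
           norm (1 - exp (- tail_sum r x j)) < 1"
proof -
  have "isCont (\<lambda>w. 1 - exp (- w) :: complex) 0" by (intro continuous_intros)
  then obtain \<delta> where "\<delta> > 0"
      "\<forall>w. dist w 0 < \<delta> \<longrightarrow> dist (1 - exp (- w)) (1 - exp (- 0) :: complex) < 1"
    unfolding continuous_at_eps_delta using zero_less_one by blast
  then have \<delta>: "\<delta> > 0" "\<And>w. norm w < \<delta> \<Longrightarrow> norm (1 - exp (- w) :: complex) < 1"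
    by (simp_all add: dist_norm)
  show ?thesis
  proof
    \<comment> \<open>A tail sum has at most \<open>r\<close> terms; dividing by
      \<open>r + 1\<close> keeps the final bound strict and is safe for
      \<open>r = 0\<close>.\<close>
    show "\<delta> / (real r + 1) > 0" using \<delta>(1) by simp
    fix x :: "nat \<Rightarrow> complex" and j
    assume x: "\<forall>j\<in>{1..r}. norm (x j) < \<delta> / (real r + 1)" and j: "j \<in> {1..r}"
    have "norm (tail_sum r x j) \<le> (\<Sum>\<nu>=j..r. norm (x \<nu>))"
      unfolding tail_sum_def by (rule norm_sum)
    also have "\<dots> \<le> (\<Sum>\<nu>=1..r. norm (x \<nu>))" using j by (intro sum_mono2) auto
    also have "\<dots> \<le> (\<Sum>\<nu>=1..r. \<delta> / (real r + 1))"
      using x by (intro sum_mono less_imp_le) auto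
    also have "\<dots> = real r * (\<delta> / (real r + 1))" by simp
    also have "\<dots> < \<delta>" using \<delta>(1) by (simp add: field_simps)
    finally show "norm (1 - exp (- tail_sum r x j)) < 1" by (rule \<delta>(2))
  qed
qed

text \<open>The generating function is a finite combination of products of exponentials by
  \<open>bern_gen_neg_nat\<close>, and each product is expanded by
  \<open>has_sum_prod_exp_power\<close>.\<close>

lemma is_bern_expansion_neg_nat:
  assumes "finite P"
    and "\<And>l. \<forall>j\<in>{1..r}. 1 \<le> l j \<Longrightarrow>
      partial_sum_powers r k l = (\<Sum>p\<in>P. bern_diff r k p * newton_basis {1..r} p l)"
  shows "is_bern_expansion r (\<lambda>j. - of_nat (k j)) (\<lambda>m. \<Sum>p\<in>P. bern_diff r k p * bern_diff r m p)"
proof -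
  obtain \<epsilon> where \<epsilon>: "\<epsilon> > 0"
    "\<And>x j. \<forall>j\<in>{1..r}. norm (x j) < \<epsilon> \<Longrightarrow> j \<in> {1..r} \<Longrightarrow> norm (1 - exp (- tail_sum r x j)) < 1"
    using tail_sum_near_0[of r] by blast
  show ?thesis
    unfolding is_bern_expansion_def
  proof (intro exI[of _ \<epsilon>] conjI allI impI \<epsilon>(1))
    fix x :: "nat \<Rightarrow> complex" assume x: "\<forall>j\<in>{1..r}. norm (x j) < \<epsilon>"
    have gen: "bern_gen r (\<lambda>j. - of_nat (k j)) x = (\<Sum>p\<in>P. bern_diff r k p *
       (\<Prod>j=1..r. exp (tail_sum r x j) * (exp (tail_sum r x j) - 1) ^ p j))"
      using \<epsilon>(2)[OF x] assms by (rule bern_gen_neg_nat)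
    show "((\<lambda>m. (\<Sum>p\<in>P. bern_diff r k p * bern_diff r m p) *
          ((\<Prod>j=1..r. x j ^ m j) / (\<Prod>j=1..r. fact (m j))))
        has_sum bern_gen r (\<lambda>j. - of_nat (k j)) x) ({1..r} \<rightarrow>\<^sub>E UNIV)"
      unfolding gen sum_distrib_right mult.assoc
      using assms(1) by (intro has_sum_sum_finite has_sum_cmult_right has_sum_prod_exp_power)
  qed
qed

lemma is_bern_expansion_unique:
  assumes "is_bern_expansion r s c" "is_bern_expansion r s c'" "m \<in> {1..r} \<rightarrow>\<^sub>E UNIV"
  shows "c m = c' m"
proof -
  define F where "F m = (\<Prod>j=1..r. fact (m j) :: complex)" for m :: "nat \<Rightarrow> nat"
  obtain \<epsilon> where \<epsilon>: "\<epsilon> > 0" "\<And>x. \<forall>j\<in>{1..r}. norm (x j) < \<epsilon> \<Longrightarrow>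
      ((\<lambda>m. c m * ((\<Prod>j=1..r. x j ^ m j) / F m)) has_sum bern_gen r s x) ({1..r} \<rightarrow>\<^sub>E UNIV)"
    using assms(1) unfolding is_bern_expansion_def F_def by blast
  obtain \<epsilon>' where \<epsilon>': "\<epsilon>' > 0" "\<And>x. \<forall>j\<in>{1..r}. norm (x j) < \<epsilon>' \<Longrightarrow>
      ((\<lambda>m. c' m * ((\<Prod>j=1..r. x j ^ m j) / F m)) has_sum bern_gen r s x) ({1..r} \<rightarrow>\<^sub>E UNIV)"
    using assms(2) unfolding is_bern_expansion_def F_def by blast
  have "(c m - c' m) / F m = 0"
  \<comment> \<open>The nonzero factorials are absorbed into the coefficients, and both expansions
    hold within the smaller radius.\<close>
  proof (rule multi_powser_has_sum_0_imp_coeff_0[of "{1..r}" "min \<epsilon> \<epsilon>'" "\<lambda>m. (c m - c' m) / F m"])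
    fix x :: "nat \<Rightarrow> complex" assume x: "\<forall>j\<in>{1..r}. norm (x j) < min \<epsilon> \<epsilon>'"
    have "((\<lambda>m. c m * ((\<Prod>j=1..r. x j ^ m j) / F m) - c' m * ((\<Prod>j=1..r. x j ^ m j) / F m))
        has_sum bern_gen r s x - bern_gen r s x) ({1..r} \<rightarrow>\<^sub>E UNIV)"
      using x has_sum_add[OF \<epsilon>(2) has_sum_uminusI[OF \<epsilon>'(2)], of x x] by simp
    then show "((\<lambda>m. (c m - c' m) / F m * (\<Prod>j=1..r. x j ^ m j)) has_sum 0) ({1..r} \<rightarrow>\<^sub>E UNIV)"
      by (simp add: diff_divide_distrib left_diff_distrib)
  qed (use \<epsilon>(1) \<epsilon>'(1) assms(3) in auto)
  then show ?thesis by (simp add: F_def)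
qed

text \<open>Uniqueness of the expansion makes the definite description well defined, so any one
  expansion computes it.\<close>

lemma multi_poly_bern_eqI:
  assumes "is_bern_expansion r s c"
  shows "multi_poly_bern r s m = c (restrict m {1..r})"
  unfolding multi_poly_bern_def
proof (rule the_equality)
  fix b assume "\<exists>c. is_bern_expansion r s c \<and> b = c (restrict m {1..r})"
  then show "b = c (restrict m {1..r})"
    using is_bern_expansion_unique[OF _ assms] by auto
qed (use assms in blast)

section \<open>Symmetry in \<open>k\<close> and \<open>m\<close>\<close>

lemma bern_diff_restrict: "bern_diff r (restrict m {1..r}) p = bern_diff r m p"
  unfolding finite_diff_def partial_sum_powers_def by simp

theorem theorem5p4:
  fixes r :: nat and m k :: "nat \<Rightarrow> nat"
  assumes "1 \<le> r"
  shows "multi_poly_bern r (\<lambda>j. - of_nat (k j)) m = multi_poly_bern r (\<lambda>j. - of_nat (m j)) k"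
proof -
  obtain P where P: "finite P" "P \<subseteq> {1..r} \<rightarrow>\<^sub>E UNIV"
    "\<And>l. \<forall>j\<in>{1..r}. 1 \<le> l j \<Longrightarrow>
      partial_sum_powers r k l = (\<Sum>p\<in>P. bern_diff r k p * newton_basis {1..r} p l)"
    "\<And>p. p \<in> ({1..r} \<rightarrow>\<^sub>E UNIV) - P \<Longrightarrow> bern_diff r k p = 0"
    using newton_expansion[OF _ newton_expandable_partial_sum_powers[of r k]] by auto
  obtain Q where Q: "finite Q" "Q \<subseteq> {1..r} \<rightarrow>\<^sub>E UNIV"
    "\<And>l. \<forall>j\<in>{1..r}. 1 \<le> l j \<Longrightarrow>
      partial_sum_powers r m l = (\<Sum>p\<in>Q. bern_diff r m p * newton_basis {1..r} p l)"
    "\<And>p. p \<in> ({1..r} \<rightarrow>\<^sub>E UNIV) - Q \<Longrightarrow> bern_diff r m p = 0"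
    using newton_expansion[OF _ newton_expandable_partial_sum_powers[of r m]] by auto
  have "multi_poly_bern r (\<lambda>j. - of_nat (k j)) m = (\<Sum>p\<in>P. bern_diff r k p * bern_diff r m p)"
    using multi_poly_bern_eqI[OF is_bern_expansion_neg_nat[OF P(1,3)], of m]
    by (simp only: bern_diff_restrict)
  \<comment> \<open>The supports \<open>P\<close> and \<open>Q\<close> may differ, but a term
    outside either one has a vanishing factor, so both sums reduce to the intersection.\<close>
  also have "\<dots> = (\<Sum>p\<in>P \<inter> Q. bern_diff r k p * bern_diff r m p)"
    using P(1,2) Q(4) by (intro sum.mono_neutral_right ballI) (blast, blast, simp only: mult_eq_0_iff, blast)
  also have "\<dots> = (\<Sum>p\<in>Q. bern_diff r k p * bern_diff r m p)"
    using Q(1,2) P(4) by (intro sum.mono_neutral_left ballI) (blast, blast, simp only: mult_eq_0_iff, blast)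
  also have "\<dots> = multi_poly_bern r (\<lambda>j. - of_nat (m j)) k"
    using multi_poly_bern_eqI[OF is_bern_expansion_neg_nat[OF Q(1,3)], of k]
    by (simp only: bern_diff_restrict mult.commute)
  finally show ?thesis .
qed

end
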